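(* Assume that $a_\varepsilon\in L^\infty(\Omega)$ satisfies $0<a_0\le a_\varepsilon(x)\le a_1<\infty$ for a.e. $x\in\Omega$, and let $\alpha\ge0$. Then the form $$A_h(u_h;v_h)=\int_\Omega a_\varepsilon(x)\bigl(1+\alpha|\nabla u_h|^2\bigr)\nabla u_h\cdot\nabla v_h\,dx,\qquad u_h,v_h\in V_h,$$ is strongly monotone, locally Lipschitz continuous, and differentiable in its first argument. More precisely: (a) For all $v_h,w_h\in V_h$, $$A_h(v_h;v_h-w_h)-A_h(w_h;v_h-w_h)\ge a_0\|v_h-w_h\|_V^2 .$$ (b) There is a constant $C$ depending only on the dimension and the shape regularity of the finite element mesh such that for every $K>0$ and all $v_h,w_h\in\mathcal B_K=\{v_h\in V_h:\|\nabla v_h\|_{L^\infty(\Omega)}\le K\}$, $$\|A_h(v_h;\cdot)-A_h(w_h;\cdot)\|_{V_h'}\le a_1\bigl(1+C\alpha K^2\bigr)\|v_h-w_h\|_V .$$ (c) The derivative of $A_h$ in its first argument at $u_h$ in direction $z_h$, tested with $r_h$, is $$A_h'(u_h)[z_h,r_h]=\int_\Omega a_\varepsilon(x)\bigl(1+\alpha|\nabla u_h|^2\bigr)\nabla z_h\cdot\nabla r_h\,dx+2\alpha\int_\Omega a_\varepsilon(x)(\nabla u_h\cdot\nabla z_h)(\nabla u_h\cdot\nabla r_h)\,dx,$$ and it satisfies, for all $u_h,z_h\in V_h$, $$A_h'(u_h)[z_h,z_h]\ge a_0\|z_h\|_V^2 .$$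
   Context: $\Omega\subset\mathbb R^d$ is a bounded polygonal or polyhedral domain, $\mathcal T_h$ is a shape-regular, quasi-uniform triangulation of $\Omega$, and $V_h\subset H_0^1(\Omega)$ is the space of continuous piecewise linear finite element functions on $\mathcal T_h$ vanishing on $\partial\Omega$. The energy norm is $\|v_h\|_V=\|\nabla v_h\|_{L^2(\Omega)}$, and $\|F\|_{V_h'}=\sup_{0\ne v_h\in V_h}|F(v_h)|/\|v_h\|_V$ for a linear functional $F$ on $V_h$. *)

theory Defs
  imports "HOL-Analysis.Analysis" "HOL-Probability.Essential_Supremum"
begin

definition polyhedral_domain :: "(real^'n) set \<Rightarrow> bool" where
  "polyhedral_domain \<Omega> \<longleftrightarrow>
     \<Omega> \<noteq> {} \<and> open \<Omega> \<and> connected \<Omega> \<and> bounded \<Omega> \<and>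
     (\<exists>\<P>. finite \<P> \<and> (\<forall>P\<in>\<P>. polytope P \<and> aff_dim P = int CARD('n) - 1) \<and>
          frontier \<Omega> = \<Union>\<P>)"

definition triangulation_of :: "(real^'n) set set \<Rightarrow> (real^'n) set \<Rightarrow> bool" where
  "triangulation_of \<T> \<Omega> \<longleftrightarrow>
     triangulation \<T> \<and> (\<forall>T\<in>\<T>. int CARD('n) simplex T) \<and> \<Union>\<T> = closure \<Omega>"

definition inball_diameter :: "(real^'n) set \<Rightarrow> real" where
  "inball_diameter T = Sup {2 * r | r. 0 \<le> r \<and> (\<exists>c. cball c r \<subseteq> T)}"

definition shape_regular :: "real \<Rightarrow> (real^'n) set set \<Rightarrow> bool" where
  "shape_regular \<sigma> \<T> \<longleftrightarrow> (\<forall>T\<in>\<T>. diameter T \<le> \<sigma> * inball_diameter T)"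

definition quasi_uniform :: "real \<Rightarrow> (real^'n) set set \<Rightarrow> bool" where
  "quasi_uniform q \<T> \<longleftrightarrow> (\<forall>T\<in>\<T>. Max (diameter ` \<T>) \<le> q * diameter T)"

(* Finite element functions are extended by zero outside the domain, so that
   equality of functions on the domain is equality of HOL functions. *)
definition fe_space :: "(real^'n) set \<Rightarrow> (real^'n) set set \<Rightarrow> (real^'n \<Rightarrow> real) set" where
  "fe_space \<Omega> \<T> =
     {v. continuous_on (closure \<Omega>) v \<and>
         (\<forall>T\<in>\<T>. \<exists>g c. \<forall>x\<in>T. v x = g \<bullet> x + c) \<and>
         (\<forall>x\<in>frontier \<Omega>. v x = 0) \<and>
         (\<forall>x. x \<notin> closure \<Omega> \<longrightarrow> v x = 0)}"

(* A finite element function is affine on every element, so its classical gradient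
   exists in the interior of every element, that is almost everywhere in the domain,
   and represents the weak gradient.  The value of grad at the remaining points is
   unspecified; grad is only used under integrals and essential suprema. *)
definition grad :: "(real^'n \<Rightarrow> real) \<Rightarrow> real^'n \<Rightarrow> real^'n" where
  "grad v x = (THE D. GDERIV v x :> D)"

definition Linf_norm :: "(real^'n) set \<Rightarrow> (real^'n \<Rightarrow> 'b::real_normed_vector) \<Rightarrow> ereal" where
  "Linf_norm \<Omega> f = esssup (lebesgue_on \<Omega>) (\<lambda>x. ereal (norm (f x)))"

definition Linf :: "(real^'n) set \<Rightarrow> (real^'n \<Rightarrow> real) set" where
  "Linf \<Omega> = {f \<in> borel_measurable (lebesgue_on \<Omega>). Linf_norm \<Omega> f < \<infinity>}"

definition energy_norm :: "(real^'n) set \<Rightarrow> (real^'n \<Rightarrow> real) \<Rightarrow> real" where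
  "energy_norm \<Omega> v = sqrt (\<integral>x. (norm (grad v x))\<^sup>2 \<partial>lebesgue_on \<Omega>)"

(* Taken in the extended nonnegative reals: the supremum over the empty set is 0
   (case of the trivial space), and a finite bound includes boundedness. *)
definition dual_norm ::
    "(real^'n) set \<Rightarrow> (real^'n) set set \<Rightarrow> ((real^'n \<Rightarrow> real) \<Rightarrow> real) \<Rightarrow> ennreal" where
  "dual_norm \<Omega> \<T> F =
     (SUP v \<in> fe_space \<Omega> \<T> - {\<lambda>x. 0}. ennreal (\<bar>F v\<bar> / energy_norm \<Omega> v))"

definition A_form :: "(real^'n) set \<Rightarrow> (real^'n \<Rightarrow> real) \<Rightarrow> real \<Rightarrow>
    (real^'n \<Rightarrow> real) \<Rightarrow> (real^'n \<Rightarrow> real) \<Rightarrow> real" where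
  "A_form \<Omega> a \<alpha> u v =
     (\<integral>x. a x * (1 + \<alpha> * (norm (grad u x))\<^sup>2) * (grad u x \<bullet> grad v x) \<partial>lebesgue_on \<Omega>)"

definition A_deriv :: "(real^'n) set \<Rightarrow> (real^'n \<Rightarrow> real) \<Rightarrow> real \<Rightarrow>
    (real^'n \<Rightarrow> real) \<Rightarrow> (real^'n \<Rightarrow> real) \<Rightarrow> (real^'n \<Rightarrow> real) \<Rightarrow> real" where
  "A_deriv \<Omega> a \<alpha> u z r =
     (\<integral>x. a x * (1 + \<alpha> * (norm (grad u x))\<^sup>2) * (grad z x \<bullet> grad r x) \<partial>lebesgue_on \<Omega>)
     + 2 * \<alpha> *
       (\<integral>x. a x * (grad u x \<bullet> grad z x) * (grad u x \<bullet> grad r x) \<partial>lebesgue_on \<Omega>)"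

definition linear_functional_on_fe ::
    "(real^'n) set \<Rightarrow> (real^'n) set set \<Rightarrow> ((real^'n \<Rightarrow> real) \<Rightarrow> real) \<Rightarrow> bool" where
  "linear_functional_on_fe \<Omega> \<T> F \<longleftrightarrow>
     (\<forall>v\<in>fe_space \<Omega> \<T>. \<forall>w\<in>fe_space \<Omega> \<T>. \<forall>b c.
        F (\<lambda>x. b * v x + c * w x) = b * F v + c * F w)"

(* The Frechet derivative at u of the map sending u to the functional F u, from the
   finite element space with the energy norm to its dual with the dual norm, is L:
   L is bounded and linear, and the remainder is o of the energy norm of z. *)
definition has_fe_derivative ::
    "(real^'n) set \<Rightarrow> (real^'n) set set \<Rightarrow>
     ((real^'n \<Rightarrow> real) \<Rightarrow> (real^'n \<Rightarrow> real) \<Rightarrow> real) \<Rightarrow>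
     ((real^'n \<Rightarrow> real) \<Rightarrow> (real^'n \<Rightarrow> real) \<Rightarrow> real) \<Rightarrow> (real^'n \<Rightarrow> real) \<Rightarrow> bool" where
  "has_fe_derivative \<Omega> \<T> F L u \<longleftrightarrow>
     (\<forall>z\<in>fe_space \<Omega> \<T>. linear_functional_on_fe \<Omega> \<T> (L z)) \<and>
     (\<forall>r\<in>fe_space \<Omega> \<T>. linear_functional_on_fe \<Omega> \<T> (\<lambda>z. L z r)) \<and>
     (\<exists>B\<ge>0. \<forall>z\<in>fe_space \<Omega> \<T>. dual_norm \<Omega> \<T> (L z) \<le> ennreal (B * energy_norm \<Omega> z)) \<and>
     (\<forall>e>0. \<exists>\<delta>>0. \<forall>z\<in>fe_space \<Omega> \<T>. energy_norm \<Omega> z < \<delta> \<longrightarrow>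
        dual_norm \<Omega> \<T> (\<lambda>r. F (\<lambda>x. u x + z x) r - F u r - L z r)
          \<le> ennreal (e * energy_norm \<Omega> z))"

end

theory Submission
  imports Defs
begin

text \<open>The gradient of a finite element function is constant on each element, hence measurable and
  essentially bounded, so every integral below exists. All three claims then reduce to pointwise
  estimates for the cubic map \<open>p \<mapsto> (1 + \<alpha> |p|\<^sup>2) p\<close>: it is strongly monotone because
  \<open>(|p|\<^sup>2 p - |q|\<^sup>2 q) \<bullet> (p - q) = (|p|\<^sup>2 + |q|\<^sup>2) |p - q|\<^sup>2 / 2 + (|p|\<^sup>2 - |q|\<^sup>2)\<^sup>2 / 2\<close>,
  it is Lipschitz with constant \<open>1 + 3 \<alpha> K\<^sup>2\<close> on the ball of radius \<open>K\<close> (so \<open>C = 3\<close> works),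
  and it has an exact third-order Taylor expansion.\<close>

section \<open>Essentially bounded functions\<close>

text \<open>The bound is a real number, not an extended essential supremum, so closure under sums
  and products is elementary. On a finite measure space the predicate gives integrability, and the
  closure rules then settle integrability and measurability of every integrand term by term.\<close>

definition ess_bounded :: "'a measure \<Rightarrow> ('a \<Rightarrow> 'b::real_normed_vector) \<Rightarrow> bool" where
  "ess_bounded M f \<longleftrightarrow> f \<in> borel_measurable M \<and> (\<exists>K. AE x in M. norm (f x) \<le> K)"

lemma ess_boundedI:
  "f \<in> borel_measurable M \<Longrightarrow> AE x in M. norm (f x) \<le> K \<Longrightarrow> ess_bounded M f"
  by (auto simp: ess_bounded_def)

lemma ess_bounded_measurable: "ess_bounded M f \<Longrightarrow> f \<in> borel_measurable M"
  by (simp add: ess_bounded_def)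

lemma ess_bounded_const: "ess_bounded M (\<lambda>x. c)"
  by (rule ess_boundedI[where K = "norm c"]) auto

lemma ess_bounded_add:
  fixes f g :: "'a \<Rightarrow> 'b::{real_normed_vector, second_countable_topology}"
  assumes "ess_bounded M f" "ess_bounded M g"
  shows "ess_bounded M (\<lambda>x. f x + g x)"
proof -
  obtain K L where "AE x in M. norm (f x) \<le> K" "AE x in M. norm (g x) \<le> L"
    using assms by (auto simp: ess_bounded_def)
  then have "AE x in M. norm (f x + g x) \<le> K + L"
    by eventually_elim (rule norm_add_rule_thm)
  with assms show ?thesis
    by (auto simp: ess_bounded_def)
qed

lemma ess_bounded_scaleR:
  fixes g :: "'a \<Rightarrow> 'b::{real_normed_vector, second_countable_topology}"
  assumes "ess_bounded M f" "ess_bounded M g"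
  shows "ess_bounded M (\<lambda>x. f x *\<^sub>R g x)"
proof -
  obtain K L where "AE x in M. norm (f x) \<le> K" "AE x in M. norm (g x) \<le> L"
    using assms by (auto simp: ess_bounded_def)
  then have "AE x in M. norm (f x *\<^sub>R g x) \<le> \<bar>K\<bar> * \<bar>L\<bar>"
    by eventually_elim (auto intro!: mult_mono)
  with assms show ?thesis
    by (auto simp: ess_bounded_def)
qed

lemma ess_bounded_mult:
  fixes f g :: "'a \<Rightarrow> real"
  shows "ess_bounded M f \<Longrightarrow> ess_bounded M g \<Longrightarrow> ess_bounded M (\<lambda>x. f x * g x)"
  using ess_bounded_scaleR[of M f g] by simp

lemma ess_bounded_diff:
  fixes f g :: "'a \<Rightarrow> 'b::{real_normed_vector, second_countable_topology}"
  assumes "ess_bounded M f" "ess_bounded M g"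
  shows "ess_bounded M (\<lambda>x. f x - g x)"
  using ess_bounded_add[OF assms(1) ess_bounded_scaleR[OF ess_bounded_const[of M "-1"] assms(2)]]
  by simp

lemma ess_bounded_norm: "ess_bounded M f \<Longrightarrow> ess_bounded M (\<lambda>x. norm (f x))"
  by (auto simp: ess_bounded_def)

lemma ess_bounded_power:
  fixes f :: "'a \<Rightarrow> real"
  shows "ess_bounded M f \<Longrightarrow> ess_bounded M (\<lambda>x. f x ^ n)"
  by (induction n) (auto intro: ess_bounded_const ess_bounded_mult)

lemma ess_bounded_inner:
  fixes f g :: "'a \<Rightarrow> 'b::{real_inner, second_countable_topology}"
  assumes "ess_bounded M f" "ess_bounded M g"
  shows "ess_bounded M (\<lambda>x. f x \<bullet> g x)"
proof -
  obtain K L where "AE x in M. norm (f x) \<le> K" "AE x in M. norm (g x) \<le> L"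
    using assms by (auto simp: ess_bounded_def)
  then have "AE x in M. norm (f x \<bullet> g x) \<le> \<bar>K\<bar> * \<bar>L\<bar>"
    by eventually_elim (auto intro!: order_trans[OF Cauchy_Schwarz_ineq2] mult_mono)
  with assms show ?thesis
    by (auto simp: ess_bounded_def)
qed

lemmas ess_bounded_intros =
  ess_bounded_const ess_bounded_add ess_bounded_diff ess_bounded_scaleR ess_bounded_mult
  ess_bounded_norm ess_bounded_power ess_bounded_inner

lemma (in finite_measure) ess_bounded_integrable:
  fixes f :: "'a \<Rightarrow> 'b::{banach, second_countable_topology}"
  shows "ess_bounded M f \<Longrightarrow> integrable M f"
  by (auto simp: ess_bounded_def intro: integrable_const_bound)

text \<open>Discriminant argument: the integral of \<open>(C * f - B * g)\<^sup>2\<close> is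
  nonnegative and equals \<open>C * (A * C - B\<^sup>2)\<close>. Dividing by \<open>C\<close> is
  possible unless \<open>g\<close> vanishes almost everywhere, in which case
  \<open>B = 0\<close>.\<close>

lemma integral_cauchy_schwarz:
  fixes f g :: "'a \<Rightarrow> real"
  assumes f: "integrable M (\<lambda>x. (f x)\<^sup>2)" and g: "integrable M (\<lambda>x. (g x)\<^sup>2)"
    and fg: "integrable M (\<lambda>x. f x * g x)"
  shows "(\<integral>x. f x * g x \<partial>M) \<le> sqrt (\<integral>x. (f x)\<^sup>2 \<partial>M) * sqrt (\<integral>x. (g x)\<^sup>2 \<partial>M)"
proof -
  define A where "A = (\<integral>x. (f x)\<^sup>2 \<partial>M)"
  define B where "B = (\<integral>x. f x * g x \<partial>M)"
  define C where "C = (\<integral>x. (g x)\<^sup>2 \<partial>M)"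
  have "C \<ge> 0" by (simp add: C_def)
  have "B\<^sup>2 \<le> A * C"
  proof (cases "C = 0")
    case True
    then have "AE x in M. (g x)\<^sup>2 = 0"
      using integral_nonneg_eq_0_iff_AE[OF g] by (simp add: C_def)
    then have "AE x in M. f x * g x = 0"
      by eventually_elim simp
    then have "B = 0"
      unfolding B_def by (rule integral_eq_zero_AE)
    with True show ?thesis by simp
  next
    case False
    have "0 \<le> (\<integral>x. (C * f x - B * g x)\<^sup>2 \<partial>M)"
      by simp
    also have "\<dots> = (\<integral>x. C\<^sup>2 * (f x)\<^sup>2 - 2 * C * B * (f x * g x) + B\<^sup>2 * (g x)\<^sup>2 \<partial>M)"
      by (intro Bochner_Integration.integral_cong) (auto simp: power2_eq_square algebra_simps)
    also have "\<dots> = C\<^sup>2 * A - 2 * C * B * B + B\<^sup>2 * C"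
      using f g fg by (simp add: A_def B_def C_def)
    also have "\<dots> = C * (A * C - B\<^sup>2)"
      by (simp add: power2_eq_square algebra_simps)
    finally show ?thesis
      using False \<open>C \<ge> 0\<close> by (simp add: zero_le_mult_iff)
  qed
  then have "\<bar>B\<bar> \<le> sqrt (A * C)"
    by (rule real_le_rsqrt[of "\<bar>B\<bar>", simplified])
  then show ?thesis
    by (simp add: A_def B_def C_def real_sqrt_mult)
qed

section \<open>The pointwise nonlinearity\<close>

text \<open>The vector field of the form without the coefficient: \<open>A_form\<close> pairs
  \<open>a x\<close> times the flux of \<open>grad u x\<close> with the gradient of the test
  function.\<close>

definition flux :: "real \<Rightarrow> 'a::real_inner \<Rightarrow> 'a" where
  "flux \<alpha> p = (1 + \<alpha> * (norm p)\<^sup>2) *\<^sub>R p"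

definition flux_deriv :: "real \<Rightarrow> 'a::real_inner \<Rightarrow> 'a \<Rightarrow> 'a" where
  "flux_deriv \<alpha> p h = (1 + \<alpha> * (norm p)\<^sup>2) *\<^sub>R h + (2 * \<alpha> * (p \<bullet> h)) *\<^sub>R p"

text \<open>With \<open>flux_cubic\<close> below, these are the coefficients of the second and third
  power of \<open>t\<close> in \<open>flux \<alpha> (p + t *\<^sub>R h)\<close>.\<close>

definition flux_quad :: "real \<Rightarrow> 'a::real_inner \<Rightarrow> 'a \<Rightarrow> 'a" where
  "flux_quad \<alpha> p h = (2 * \<alpha> * (p \<bullet> h)) *\<^sub>R h + (\<alpha> * (norm h)\<^sup>2) *\<^sub>R p"

definition flux_cubic :: "real \<Rightarrow> 'a::real_inner \<Rightarrow> 'a" where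
  "flux_cubic \<alpha> h = (\<alpha> * (norm h)\<^sup>2) *\<^sub>R h"

text \<open>The flux is a cubic polynomial in its argument, so the Taylor expansion terminates.
  Derivatives and remainders of the form can later be read off by algebra, with no limit taken under
  an integral.\<close>

lemma flux_expand:
  "flux \<alpha> (p + t *\<^sub>R h) =
     flux \<alpha> p + t *\<^sub>R flux_deriv \<alpha> p h + t\<^sup>2 *\<^sub>R flux_quad \<alpha> p h + t ^ 3 *\<^sub>R flux_cubic \<alpha> h"
proof -
  have n: "(norm (p + t *\<^sub>R h))\<^sup>2 = (norm p)\<^sup>2 + 2 * t * (p \<bullet> h) + t\<^sup>2 * (norm h)\<^sup>2"
    by (simp add: power2_norm_eq_inner inner_add inner_commute[of h p])
      (simp add: power2_eq_square algebra_simps)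
  show ?thesis
    unfolding flux_def flux_deriv_def flux_quad_def flux_cubic_def n
    by (simp add: scaleR_add_left scaleR_add_right distrib_left distrib_right
        power2_eq_square power3_eq_cube) (simp add: mult_ac)
qed

lemma flux_mono:
  assumes "0 \<le> \<alpha>"
  shows "(flux \<alpha> p - flux \<alpha> q) \<bullet> (p - q) \<ge> (norm (p - q))\<^sup>2"
proof -
  have "(flux \<alpha> p - flux \<alpha> q) \<bullet> (p - q) = (norm (p - q))\<^sup>2
      + \<alpha> / 2 * (((norm p)\<^sup>2 + (norm q)\<^sup>2) * (norm (p - q))\<^sup>2 + ((norm p)\<^sup>2 - (norm q)\<^sup>2)\<^sup>2)"
    unfolding flux_def power2_norm_eq_inner
    by (simp add: inner_diff inner_commute[of q p]) (simp add: power2_eq_square field_simps)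
  with assms show ?thesis by simp
qed

text \<open>Both contributions of the nonlinearity, from the weight and from the rank-one term, are
  nonnegative in the direction \<open>h\<close>.\<close>

lemma flux_deriv_coercive:
  assumes "0 \<le> \<alpha>"
  shows "flux_deriv \<alpha> p h \<bullet> h \<ge> (norm h)\<^sup>2"
proof -
  have "flux_deriv \<alpha> p h \<bullet> h = (norm h)\<^sup>2 + \<alpha> * (norm p)\<^sup>2 * (norm h)\<^sup>2 + 2 * \<alpha> * (p \<bullet> h)\<^sup>2"
    by (simp add: flux_deriv_def inner_add power2_norm_eq_inner)
      (simp add: power2_eq_square algebra_simps)
  with assms show ?thesis by simp
qed

text \<open>The factor 3 is 1 from the weight plus 2 from the rank-one term.\<close>

lemma flux_deriv_bound:
  assumes "0 \<le> \<alpha>" "norm p \<le> K"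
  shows "norm (flux_deriv \<alpha> p h) \<le> (1 + 3 * \<alpha> * K\<^sup>2) * norm h"
proof -
  have "norm (flux_deriv \<alpha> p h) \<le> (1 + \<alpha> * (norm p)\<^sup>2) * norm h + 2 * \<alpha> * \<bar>p \<bullet> h\<bar> * norm p"
    unfolding flux_deriv_def using assms(1)
    by (intro order_trans[OF norm_triangle_ineq]) (simp add: abs_mult)
  also have "\<dots> \<le> (1 + \<alpha> * (norm p)\<^sup>2) * norm h + 2 * \<alpha> * (norm p * norm h) * norm p"
    using assms(1) by (intro add_left_mono mult_right_mono mult_left_mono Cauchy_Schwarz_ineq2) auto
  also have "\<dots> = (1 + 3 * \<alpha> * (norm p)\<^sup>2) * norm h"
    by (simp add: power2_eq_square algebra_simps)
  also have "\<dots> \<le> (1 + 3 * \<alpha> * K\<^sup>2) * norm h"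
    using assms by (intro mult_right_mono add_left_mono mult_left_mono power_mono) auto
  finally show ?thesis .
qed

lemma flux_lipschitz:
  assumes "0 \<le> \<alpha>" "norm p \<le> K" "norm q \<le> K"
  shows "norm (flux \<alpha> p - flux \<alpha> q) \<le> (1 + 3 * \<alpha> * K\<^sup>2) * norm (p - q)"
proof -
  have K: "0 \<le> K" using assms(2) norm_ge_zero order_trans by blast
  \<comment> \<open>The difference of squared norms factors as
    \<open>(p - q) \<bullet> (p + q)\<close>, which exposes a factor \<open>p - q\<close> in both
    summands. The first then contributes \<open>\<alpha> * K\<^sup>2\<close> and the second twice
    that, hence the constant 3.\<close>
  have eq: "flux \<alpha> p - flux \<alpha> q =
      (1 + \<alpha> * (norm p)\<^sup>2) *\<^sub>R (p - q) + (\<alpha> * ((p - q) \<bullet> (p + q))) *\<^sub>R q"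
    by (simp add: flux_def power2_norm_eq_inner inner_diff inner_add inner_commute[of q p]
        algebra_simps)
  have "\<bar>(p - q) \<bullet> (p + q)\<bar> \<le> norm (p - q) * (2 * K)"
    using assms norm_triangle_ineq[of p q]
    by (intro order_trans[OF Cauchy_Schwarz_ineq2] mult_left_mono) auto
  then have "\<bar>(p - q) \<bullet> (p + q)\<bar> * norm q \<le> norm (p - q) * (2 * K) * K"
    using assms K by (intro mult_mono) auto
  then have b: "\<alpha> * (\<bar>(p - q) \<bullet> (p + q)\<bar> * norm q) \<le> \<alpha> * (norm (p - q) * (2 * K) * K)"
    using assms(1) by (rule mult_left_mono)
  have a: "(1 + \<alpha> * (norm p)\<^sup>2) * norm (p - q) \<le> (1 + \<alpha> * K\<^sup>2) * norm (p - q)"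
    using assms by (intro mult_right_mono add_left_mono mult_left_mono power_mono) auto
  have "norm (flux \<alpha> p - flux \<alpha> q)
      \<le> (1 + \<alpha> * (norm p)\<^sup>2) * norm (p - q) + \<alpha> * (\<bar>(p - q) \<bullet> (p + q)\<bar> * norm q)"
    unfolding eq using assms(1) by (intro order_trans[OF norm_triangle_ineq]) (simp add: abs_mult)
  also have "\<dots> \<le> (1 + \<alpha> * K\<^sup>2) * norm (p - q) + \<alpha> * (norm (p - q) * (2 * K) * K)"
    using a b by (rule add_mono)
  also have "\<dots> = (1 + 3 * \<alpha> * K\<^sup>2) * norm (p - q)"
    by (simp add: power2_eq_square algebra_simps)
  finally show ?thesis .
qed

text \<open>Every term is at least quadratic in \<open>h\<close>. One factor \<open>norm h\<close>
  is kept for the energy norm and the others are bounded by \<open>L\<close>, so the prefactor is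
  small when \<open>L\<close> is small.\<close>

lemma flux_remainder_bound:
  assumes "0 \<le> \<alpha>" "norm p \<le> K" "norm h \<le> L"
  shows "norm (flux_quad \<alpha> p h + flux_cubic \<alpha> h) \<le> \<alpha> * (3 * K * L + L\<^sup>2) * norm h"
proof -
  have K: "0 \<le> K" using assms(2) norm_ge_zero order_trans by blast
  have L: "0 \<le> L" using assms(3) norm_ge_zero order_trans by blast
  have "norm (flux_quad \<alpha> p h + flux_cubic \<alpha> h)
      \<le> (2 * \<alpha> * \<bar>p \<bullet> h\<bar>) * norm h + (\<alpha> * (norm h)\<^sup>2) * norm p + (\<alpha> * (norm h)\<^sup>2) * norm h"
    unfolding flux_quad_def flux_cubic_def using assms(1)
    by (intro order_trans[OF norm_triangle_ineq] add_mono) (simp_all add: abs_mult)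
  also have "\<dots> \<le> (2 * \<alpha> * (norm p * norm h)) * norm h + (\<alpha> * (norm h)\<^sup>2) * norm p
      + (\<alpha> * (norm h)\<^sup>2) * norm h"
    using assms(1) by (intro add_right_mono mult_right_mono mult_left_mono Cauchy_Schwarz_ineq2) auto
  also have "\<dots> = \<alpha> * (3 * norm p * norm h + (norm h)\<^sup>2) * norm h"
    by (simp add: power2_eq_square algebra_simps)
  also have "\<dots> \<le> \<alpha> * (3 * K * L + L\<^sup>2) * norm h"
    using assms K L by (intro mult_right_mono mult_left_mono add_mono mult_mono power_mono) auto
  finally show ?thesis .
qed

lemma ess_bounded_flux:
  fixes f g :: "'a \<Rightarrow> 'b::{real_inner, second_countable_topology}"
  assumes "ess_bounded M f"
  shows "ess_bounded M (\<lambda>x. flux \<alpha> (f x))"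
    and "ess_bounded M (\<lambda>x. flux_cubic \<alpha> (f x))"
    and "ess_bounded M g \<Longrightarrow> ess_bounded M (\<lambda>x. flux_deriv \<alpha> (f x) (g x))"
    and "ess_bounded M g \<Longrightarrow> ess_bounded M (\<lambda>x. flux_quad \<alpha> (f x) (g x))"
  unfolding flux_def flux_deriv_def flux_quad_def flux_cubic_def
  using assms by (auto intro!: ess_bounded_intros)

section \<open>Gradients of finite element functions\<close>

text \<open>Since \<open>grad\<close> is a definite description, both existence and uniqueness of
  the gradient are needed. An affine formula on an open neighbourhood gives existence, and
  uniqueness of the derivative gives the rest.\<close>

lemma grad_affine_on:
  fixes v :: "real^'n \<Rightarrow> real"
  assumes "open S" "x \<in> S" "\<And>y. y \<in> S \<Longrightarrow> v y = g \<bullet> y + c"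
  shows "grad v x = g"
proof -
  have "((\<lambda>y. g \<bullet> y + c) has_derivative (\<lambda>h. h \<bullet> g)) (at x)"
    by (auto intro!: derivative_eq_intros simp: inner_commute)
  then have *: "GDERIV v x :> g"
    unfolding gderiv_def
    by (rule has_derivative_transform_within_open[OF _ assms(1,2)]) (simp add: assms(3))
  show ?thesis
    unfolding grad_def
  proof (rule the_equality)
    fix D assume "GDERIV v x :> D"
    then have "(\<lambda>h. h \<bullet> D) = (\<lambda>h. h \<bullet> g)"
      using * has_derivative_unique unfolding gderiv_def by blast
    then show "D = g"
      by (metis vector_eq_ldot)
  qed (rule *)
qed

locale fe_mesh =
  fixes \<Omega> :: "(real^'n) set" and \<T> :: "(real^'n) set set"
  assumes open_domain: "open \<Omega>" and bounded_domain: "bounded \<Omega>" and nonempty_domain: "\<Omega> \<noteq> {}"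
    and tri: "triangulation_of \<T> \<Omega>"
begin

abbreviation "V \<equiv> fe_space \<Omega> \<T>"

abbreviation "\<mu> \<equiv> lebesgue_on \<Omega>"

text \<open>The intersection with \<Omega> matters because elements are only contained in its
  closure, whose interior can be larger than the domain, as for a slit domain.\<close>

definition elem :: "(real^'n) set \<Rightarrow> (real^'n) set" where
  "elem T = interior T \<inter> \<Omega>"

section \<open>Geometry of the mesh up to null sets\<close>

lemma domain_lmeasurable: "\<Omega> \<in> lmeasurable"
  using bounded_domain open_domain by (rule lmeasurable_open)

sublocale finite_measure \<mu>
  using domain_lmeasurable by (rule finite_measure_lebesgue_on)

lemma finite_mesh: "finite \<T>"
  using tri by (simp add: triangulation_of_def triangulation_def)

lemma simplex_mesh: "T \<in> \<T> \<Longrightarrow> int CARD('n) simplex T"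
  using tri by (simp add: triangulation_of_def)

lemma mesh_cover: "\<Union>\<T> = closure \<Omega>"
  using tri by (simp add: triangulation_of_def)

lemma open_elem: "open (elem T)"
  using open_domain by (simp add: elem_def open_Int)

lemma elem_lmeasurable: "elem T \<in> lmeasurable"
  using bounded_domain open_elem
  by (metis bounded_subset elem_def inf_le2 lmeasurable_open)

text \<open>A full-dimensional convex set has nonempty interior, and a nonempty open subset of the
  closure of \<Omega> meets \<Omega>.\<close>

lemma elem_nonempty:
  assumes T: "T \<in> \<T>"
  shows "elem T \<noteq> {}"
proof -
  have dim: "aff_dim T = int (DIM(real^'n))" and "convex T"
    using simplex_mesh[OF T] by (auto simp: aff_dim_simplex convex_simplex)
  moreover have "T \<noteq> {}"
    using dim by auto
  ultimately have "interior T \<noteq> {}"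
    using rel_interior_interior[of T] rel_interior_eq_empty[of T] aff_dim_eq_full[of T] by simp
  moreover have "interior T \<subseteq> closure \<Omega>"
    using T mesh_cover interior_subset by blast
  ultimately show ?thesis
    using open_Int_closure_eq_empty[of "interior T" \<Omega>] by (auto simp: elem_def)
qed

lemma measure_elem_pos:
  assumes "T \<in> \<T>"
  shows "0 < measure lebesgue (elem T)"
  using open_not_negligible[OF open_elem elem_nonempty[OF assms]]
    negligible_iff_measure0[OF elem_lmeasurable] measure_nonneg
  by (metis less_eq_real_def)

text \<open>Boundaries of convex sets are negligible and the mesh is finite. A point of \<Omega>
  outside all these boundaries is interior to any element containing it.\<close>

lemma AE_elem: "AE x in \<mu>. x \<in> (\<Union>T\<in>\<T>. elem T)"
proof -
  have "negligible (\<Union>T\<in>\<T>. frontier T)"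
    using finite_mesh simplex_mesh
    by (intro negligible_Union) (auto intro: negligible_convex_frontier convex_simplex)
  then have "AE x in lebesgue. x \<notin> (\<Union>T\<in>\<T>. frontier T)"
    unfolding negligible_iff_null_sets by (rule AE_not_in)
  then have "AE x in lebesgue. x \<in> \<Omega> \<longrightarrow> x \<in> (\<Union>T\<in>\<T>. elem T)"
  proof eventually_elim
    case (elim x)
    show ?case
    proof
      assume x: "x \<in> \<Omega>"
      then obtain T where T: "T \<in> \<T>" "x \<in> T"
        using mesh_cover closure_subset by blast
      then have "x \<in> interior T"
        using elim closure_subset unfolding frontier_def by blast
      with x T show "x \<in> (\<Union>T\<in>\<T>. elem T)"
        by (auto simp: elem_def)
    qed
  qed
  then show ?thesis
    using open_domain by (subst AE_restrict_space_iff) auto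
qed

section \<open>Piecewise constant gradients and linear structure\<close>

lemma fe_affine:
  assumes "v \<in> V" "T \<in> \<T>"
  shows "\<exists>g c. \<forall>x\<in>elem T. v x = g \<bullet> x + c"
proof -
  obtain g c where "\<forall>x\<in>T. v x = g \<bullet> x + c"
    using assms unfolding fe_space_def by blast
  then have "\<forall>x\<in>elem T. v x = g \<bullet> x + c"
    using interior_subset by (auto simp: elem_def)
  then show ?thesis by blast
qed

lemma grad_const_on_elem:
  assumes "v \<in> V" "T \<in> \<T>"
  shows "\<exists>g. \<forall>x\<in>elem T. grad v x = g"
proof -
  obtain g c where "\<forall>x\<in>elem T. v x = g \<bullet> x + c"
    using fe_affine[OF assms] by blast
  then have "\<forall>x\<in>elem T. grad v x = g"
    using grad_affine_on[OF open_elem] by blast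
  then show ?thesis by blast
qed

lemma grad_lincomb_on_elem:
  assumes v: "v \<in> V" and w: "w \<in> V" and T: "T \<in> \<T>" and x: "x \<in> elem T"
  shows "grad (\<lambda>x. b * v x + c * w x) x = b *\<^sub>R grad v x + c *\<^sub>R grad w x"
proof -
  obtain g k where g: "\<And>x. x \<in> elem T \<Longrightarrow> v x = g \<bullet> x + k"
    using fe_affine[OF v T] by blast
  obtain h l where h: "\<And>x. x \<in> elem T \<Longrightarrow> w x = h \<bullet> x + l"
    using fe_affine[OF w T] by blast
  have "grad (\<lambda>x. b * v x + c * w x) x = b *\<^sub>R g + c *\<^sub>R h"
    by (rule grad_affine_on[OF open_elem x, where c = "b * k + c * l"])
      (simp add: g h inner_add algebra_simps)
  moreover have "grad v x = g" "grad w x = h"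
    using grad_affine_on[OF open_elem x] g h by blast+
  ultimately show ?thesis by simp
qed

lemma fe_space_lincomb:
  assumes v: "v \<in> V" and w: "w \<in> V"
  shows "(\<lambda>x. b * v x + c * w x) \<in> V"
proof -
  have "\<exists>g k. \<forall>x\<in>T. b * v x + c * w x = g \<bullet> x + k" if T: "T \<in> \<T>" for T
  proof -
    obtain g k where g: "\<forall>x\<in>T. v x = g \<bullet> x + k"
      using v T unfolding fe_space_def by blast
    obtain h l where h: "\<forall>x\<in>T. w x = h \<bullet> x + l"
      using w T unfolding fe_space_def by blast
    show ?thesis
      by (intro exI[of _ "b *\<^sub>R g + c *\<^sub>R h"] exI[of _ "b * k + c * l"])
        (simp add: g h inner_add algebra_simps)
  qed
  with v w show ?thesis
    by (auto simp: fe_space_def intro!: continuous_intros)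
qed

lemma fe_space_diff: "v \<in> V \<Longrightarrow> w \<in> V \<Longrightarrow> (\<lambda>x. v x - w x) \<in> V"
  using fe_space_lincomb[of v w 1 "-1"] by simp

lemma fe_space_add_mult: "v \<in> V \<Longrightarrow> w \<in> V \<Longrightarrow> (\<lambda>x. v x + t * w x) \<in> V"
  using fe_space_lincomb[of v w 1 t] by simp

text \<open>Off the element interiors \<open>grad\<close> may be an unspecified value, so linearity
  is available only almost everywhere. This suffices under integrals.\<close>

lemma AE_grad_lincomb:
  assumes "v \<in> V" "w \<in> V"
  shows "AE x in \<mu>. grad (\<lambda>x. b * v x + c * w x) x = b *\<^sub>R grad v x + c *\<^sub>R grad w x"
  using AE_elem by eventually_elim (auto intro: grad_lincomb_on_elem[OF assms])

lemma AE_grad_diff: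
  "v \<in> V \<Longrightarrow> w \<in> V \<Longrightarrow> AE x in \<mu>. grad (\<lambda>x. v x - w x) x = grad v x - grad w x"
  using AE_grad_lincomb[of v w 1 "-1"] by simp

lemma AE_grad_add_mult:
  "v \<in> V \<Longrightarrow> w \<in> V \<Longrightarrow> AE x in \<mu>. grad (\<lambda>x. v x + t * w x) x = grad v x + t *\<^sub>R grad w x"
  using AE_grad_lincomb[of v w 1 t] by simp

text \<open>On the open union of the element interiors the gradient is locally constant, hence
  continuous. The rest of \<Omega> is a null set.\<close>

lemma grad_measurable:
  assumes v: "v \<in> V"
  shows "grad v \<in> borel_measurable \<mu>"
proof -
  define W where "W = (\<Union>T\<in>\<T>. elem T)"
  have W: "W \<in> sets lebesgue"
    unfolding W_def using open_UN[of \<T> elem] open_elem by (intro sets_completionI_sets) simp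
  have "continuous_on W (grad v)"
    unfolding W_def
  proof (rule continuous_on_open_Union)
    fix S assume "S \<in> elem ` \<T>"
    then obtain T where T: "T \<in> \<T>" and S: "S = elem T" by blast
    obtain g where "\<And>x. x \<in> elem T \<Longrightarrow> grad v x = g"
      using grad_const_on_elem[OF v T] by blast
    then show "continuous_on S (grad v)"
      unfolding S by (subst continuous_on_cong[OF refl]) auto
  qed (use open_elem in auto)
  then have "(\<lambda>x. if x \<in> W then grad v x else 0) \<in> borel_measurable lebesgue"
    using W by (simp add: borel_measurable_if continuous_imp_measurable_on_sets_lebesgue)
  moreover have "AE x in lebesgue. x \<in> \<Omega> \<longrightarrow> x \<in> W"
    using AE_elem open_domain by (subst (asm) AE_restrict_space_iff) (auto simp: W_def)
  \<comment> \<open>The two extensions by zero agree almost everywhere, and completeness of Lebesgue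
    measure carries measurability from one to the other.\<close>
  then have "AE x in lebesgue. (if x \<in> W then grad v x else 0) = (if x \<in> \<Omega> then grad v x else 0)"
    by eventually_elim (auto simp: W_def elem_def)
  ultimately show ?thesis
    by (rule borel_measurable_if_D[OF borel_measurable_AE])
qed

lemma grad_ess_bounded:
  assumes v: "v \<in> V"
  shows "ess_bounded \<mu> (grad v)"
proof -
  obtain G where G: "\<And>T x. T \<in> \<T> \<Longrightarrow> x \<in> elem T \<Longrightarrow> grad v x = G T"
    using grad_const_on_elem[OF v] by metis
  \<comment> \<open>Summing over the finite mesh, instead of taking a maximum, gives a bound that
    needs no nonemptiness.\<close>
  have "AE x in \<mu>. norm (grad v x) \<le> (\<Sum>T\<in>\<T>. norm (G T))"
    using AE_elem
  proof eventually_elim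
    case (elim x)
    then obtain T where "T \<in> \<T>" "x \<in> elem T" by blast
    then show ?case
      using G finite_mesh by (auto intro: member_le_sum)
  qed
  with grad_measurable[OF v] show ?thesis
    by (rule ess_boundedI)
qed

section \<open>Energy norm, inverse estimate and dual norm\<close>

lemma energy_norm_nonneg: "0 \<le> energy_norm \<Omega> v"
  by (simp add: energy_norm_def)

lemma energy_norm_sq: "(energy_norm \<Omega> v)\<^sup>2 = (\<integral>x. (norm (grad v x))\<^sup>2 \<partial>\<mu>)"
  by (simp add: energy_norm_def)

text \<open>The constant is the reciprocal square root of the smallest element volume.\<close>

lemma inverse_estimate:
  "\<exists>M\<ge>0. \<forall>v\<in>V. AE x in \<mu>. norm (grad v x) \<le> M * energy_norm \<Omega> v"
proof -
  define m where "m = Min ((\<lambda>T. measure lebesgue (elem T)) ` \<T>)"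
  have ne: "\<T> \<noteq> {}"
    using mesh_cover nonempty_domain closure_subset by force
  have m: "0 < m" and mle: "\<And>T. T \<in> \<T> \<Longrightarrow> m \<le> measure lebesgue (elem T)"
    using finite_mesh ne measure_elem_pos by (auto simp: m_def)
  have bound: "norm (grad v x) \<le> 1 / sqrt m * energy_norm \<Omega> v"
    if v: "v \<in> V" and T: "T \<in> \<T>" and x: "x \<in> elem T" for v T x
  proof -
    obtain g where g: "\<And>x. x \<in> elem T \<Longrightarrow> grad v x = g"
      using grad_const_on_elem[OF v T] by blast
    have sub: "elem T \<subseteq> \<Omega>" by (simp add: elem_def)
    have meas: "elem T \<in> sets \<mu>"
      using elem_lmeasurable sub open_domain by (subst sets_restrict_space_iff) auto
    \<comment> \<open>The gradient is constant on the element, whose volume is at least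
      \<open>m\<close>. The energy of this one element is therefore at least
      \<open>m * (norm g)\<^sup>2\<close>, and it is bounded by the total energy.\<close>
    have "m * (norm g)\<^sup>2 \<le> measure lebesgue (elem T) * (norm g)\<^sup>2"
      using mle[OF T] by (simp add: mult_right_mono)
    also have "measure lebesgue (elem T) = measure \<mu> (elem T)"
      using sub open_domain by (subst measure_restrict_space) auto
    also have "measure \<mu> (elem T) * (norm g)\<^sup>2 = (\<integral>x. indicator (elem T) x * (norm g)\<^sup>2 \<partial>\<mu>)"
      using meas sub by (simp add: Int_absorb2)
    also have "\<dots> \<le> (\<integral>x. (norm (grad v x))\<^sup>2 \<partial>\<mu>)"
    proof (rule integral_mono)
      show "integrable \<mu> (\<lambda>x. indicator (elem T) x * (norm g)\<^sup>2)"
        using meas by (intro integrable_mult_left integrable_real_indicator)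
          (auto simp: emeasure_eq_measure)
      show "integrable \<mu> (\<lambda>x. (norm (grad v x))\<^sup>2)"
        by (intro ess_bounded_integrable ess_bounded_intros grad_ess_bounded v)
    qed (auto simp: indicator_def g)
    finally have "sqrt (m * (norm g)\<^sup>2) \<le> energy_norm \<Omega> v"
      by (simp add: energy_norm_def)
    then show ?thesis
      using m by (simp add: real_sqrt_mult g[OF x] field_simps)
  qed
  have "AE x in \<mu>. norm (grad v x) \<le> 1 / sqrt m * energy_norm \<Omega> v" if "v \<in> V" for v
    using AE_elem by eventually_elim (use bound[OF that] in blast)
  with m show ?thesis
    by (intro exI[of _ "1 / sqrt m"]) auto
qed

lemma dual_norm_le:
  assumes "0 \<le> B" "\<And>r. r \<in> V \<Longrightarrow> \<bar>F r\<bar> \<le> B * energy_norm \<Omega> r"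
  shows "dual_norm \<Omega> \<T> F \<le> ennreal B"
  unfolding dual_norm_def
proof (rule SUP_least)
  fix r assume "r \<in> V - {\<lambda>x. 0}"
  \<comment> \<open>When the energy norm is zero, the quotient is 0 by the convention for division,
    so the bound follows from \<open>0 \<le> B\<close>.\<close>
  then have "\<bar>F r\<bar> / energy_norm \<Omega> r \<le> B"
    using assms energy_norm_nonneg[of r]
    by (cases "energy_norm \<Omega> r = 0") (auto simp: pos_divide_le_eq less_le)
  then show "ennreal (\<bar>F r\<bar> / energy_norm \<Omega> r) \<le> ennreal B"
    by (rule ennreal_leI)
qed

text \<open>Common passage from pointwise estimates to dual-norm bounds, by Cauchy-Schwarz first in
  the vector space and then for the integral. It serves the Lipschitz bound, the boundedness of the
  derivative and the remainder estimate.\<close>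

lemma integral_inner_grad_le:
  assumes P: "ess_bounded \<mu> P" and h: "h \<in> V" and r: "r \<in> V" and c: "0 \<le> c"
    and le: "AE x in \<mu>. norm (P x) \<le> c * norm (grad h x)"
  shows "\<bar>\<integral>x. P x \<bullet> grad r x \<partial>\<mu>\<bar> \<le> c * energy_norm \<Omega> h * energy_norm \<Omega> r"
proof -
  note bdd = grad_ess_bounded[OF h] grad_ess_bounded[OF r]
  have "\<bar>\<integral>x. P x \<bullet> grad r x \<partial>\<mu>\<bar> \<le> (\<integral>x. \<bar>P x \<bullet> grad r x\<bar> \<partial>\<mu>)"
    by (rule integral_abs_bound)
  also have "\<dots> \<le> (\<integral>x. c * (norm (grad h x) * norm (grad r x)) \<partial>\<mu>)"
  proof (rule integral_mono_AE)
    show "AE x in \<mu>. \<bar>P x \<bullet> grad r x\<bar> \<le> c * (norm (grad h x) * norm (grad r x))"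
      using le
    proof eventually_elim
      case (elim x)
      have "\<bar>P x \<bullet> grad r x\<bar> \<le> norm (P x) * norm (grad r x)"
        by (rule Cauchy_Schwarz_ineq2)
      also have "\<dots> \<le> (c * norm (grad h x)) * norm (grad r x)"
        using elim by (rule mult_right_mono) simp
      finally show ?case by (simp add: mult.assoc)
    qed
  qed (intro integrable_abs ess_bounded_integrable ess_bounded_intros P bdd)+
  also have "\<dots> = c * (\<integral>x. norm (grad h x) * norm (grad r x) \<partial>\<mu>)"
    by simp
  also have "\<dots> \<le> c * (energy_norm \<Omega> h * energy_norm \<Omega> r)"
    unfolding energy_norm_def
    by (intro mult_left_mono integral_cauchy_schwarz c ess_bounded_integrable ess_bounded_intros bdd)
  finally show ?thesis by (simp add: mult.assoc)
qed

end

section \<open>The nonlinear form\<close>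

locale fe_problem = fe_mesh \<Omega> \<T>
  for \<Omega> :: "(real^'n) set" and \<T> :: "(real^'n) set set" +
  fixes a :: "real^'n \<Rightarrow> real" and a\<^sub>0 a\<^sub>1 \<alpha> :: real
  assumes a_meas: "a \<in> borel_measurable (lebesgue_on \<Omega>)" and a0_pos: "0 < a\<^sub>0"
    and a_bounds: "AE x in lebesgue_on \<Omega>. a\<^sub>0 \<le> a x \<and> a x \<le> a\<^sub>1"
    and alpha_nonneg: "0 \<le> \<alpha>"
begin

lemma a_ess_bounded: "ess_bounded \<mu> a"
proof (rule ess_boundedI[OF a_meas])
  show "AE x in \<mu>. norm (a x) \<le> a\<^sub>1"
    using a_bounds by eventually_elim (use a0_pos in auto)
qed

text \<open>If the upper bound were negative, the two bounds on \<open>a\<close> would contradict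
  each other almost everywhere, making the nonempty open set \<Omega> negligible.\<close>

lemma a1_nonneg: "0 \<le> a\<^sub>1"
proof (rule ccontr)
  assume "\<not> 0 \<le> a\<^sub>1"
  have "AE x in \<mu>. False"
    using a_bounds by eventually_elim (use \<open>\<not> 0 \<le> a\<^sub>1\<close> a0_pos in auto)
  then have "AE x in lebesgue. x \<notin> \<Omega>"
    using open_domain by (subst (asm) AE_restrict_space_iff) auto
  then have "negligible \<Omega>"
    using open_domain by (simp add: negligible_iff_null_sets AE_iff_null_sets)
  then show False
    using open_not_negligible open_domain nonempty_domain by blast
qed

lemmas ess_bdd = ess_bounded_intros ess_bounded_flux a_ess_bounded grad_ess_bounded

lemma A_form_flux: "A_form \<Omega> a \<alpha> u v = (\<integral>x. (a x *\<^sub>R flux \<alpha> (grad u x)) \<bullet> grad v x \<partial>\<mu>)"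
  by (simp add: A_form_def flux_def mult.assoc)

text \<open>Merging the two integrals of \<open>A_deriv\<close> requires integrability of each,
  which is where the membership hypotheses enter. In \<open>A_form_flux\<close> only the integrand
  is rewritten.\<close>

lemma A_deriv_flux:
  assumes "u \<in> V" "z \<in> V" "r \<in> V"
  shows "A_deriv \<Omega> a \<alpha> u z r = (\<integral>x. (a x *\<^sub>R flux_deriv \<alpha> (grad u x) (grad z x)) \<bullet> grad r x \<partial>\<mu>)"
proof -
  have "A_deriv \<Omega> a \<alpha> u z r =
      (\<integral>x. a x * (1 + \<alpha> * (norm (grad u x))\<^sup>2) * (grad z x \<bullet> grad r x)
        + 2 * \<alpha> * (a x * (grad u x \<bullet> grad z x) * (grad u x \<bullet> grad r x)) \<partial>\<mu>)"
    unfolding A_deriv_def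
    by (subst Bochner_Integration.integral_add)
      (intro ess_bounded_integrable ess_bdd assms | simp)+
  also have "\<dots> = (\<integral>x. (a x *\<^sub>R flux_deriv \<alpha> (grad u x) (grad z x)) \<bullet> grad r x \<partial>\<mu>)"
    by (intro Bochner_Integration.integral_cong)
      (auto simp: flux_deriv_def inner_add algebra_simps)
  finally show ?thesis .
qed

section \<open>Strong monotonicity and local Lipschitz continuity\<close>

lemma A_form_diff:
  assumes "v \<in> V" "w \<in> V" "r \<in> V"
  shows "A_form \<Omega> a \<alpha> v r - A_form \<Omega> a \<alpha> w r =
    (\<integral>x. (a x *\<^sub>R (flux \<alpha> (grad v x) - flux \<alpha> (grad w x))) \<bullet> grad r x \<partial>\<mu>)"
  unfolding A_form_flux
  by (subst Bochner_Integration.integral_diff[symmetric])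
    (intro ess_bounded_integrable ess_bdd assms | simp add: scaleR_diff_right inner_diff)+

lemma A_form_strongly_monotone:
  assumes v: "v \<in> V" and w: "w \<in> V"
  shows "a\<^sub>0 * (energy_norm \<Omega> (\<lambda>x. v x - w x))\<^sup>2
    \<le> A_form \<Omega> a \<alpha> v (\<lambda>x. v x - w x) - A_form \<Omega> a \<alpha> w (\<lambda>x. v x - w x)"
proof -
  note d = fe_space_diff[OF v w]
  have "a\<^sub>0 * (energy_norm \<Omega> (\<lambda>x. v x - w x))\<^sup>2 =
      (\<integral>x. a\<^sub>0 * (norm (grad (\<lambda>x. v x - w x) x))\<^sup>2 \<partial>\<mu>)"
    by (simp add: energy_norm_sq)
  also have "\<dots> \<le> (\<integral>x. (a x *\<^sub>R (flux \<alpha> (grad v x) - flux \<alpha> (grad w x)))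
      \<bullet> grad (\<lambda>x. v x - w x) x \<partial>\<mu>)"
  proof (rule integral_mono_AE)
    show "AE x in \<mu>. a\<^sub>0 * (norm (grad (\<lambda>x. v x - w x) x))\<^sup>2
      \<le> (a x *\<^sub>R (flux \<alpha> (grad v x) - flux \<alpha> (grad w x))) \<bullet> grad (\<lambda>x. v x - w x) x"
      using a_bounds AE_grad_diff[OF v w]
    proof eventually_elim
      case (elim x)
      then show ?case
        \<comment> \<open>With the gradient of the difference replaced by the difference of
          gradients, the claim is the product of \<open>a\<^sub>0 \<le> a x\<close> with the
          pointwise monotonicity, all factors being nonnegative.\<close>
        using a0_pos flux_mono[OF alpha_nonneg, of "grad v x" "grad w x"]
        by (auto intro!: mult_mono)
    qed
  qed (intro ess_bounded_integrable ess_bdd v w d)+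
  finally show ?thesis
    by (simp add: A_form_diff[OF v w d])
qed

lemma A_form_locally_lipschitz:
  assumes v: "v \<in> V" and w: "w \<in> V"
    and vK: "Linf_norm \<Omega> (grad v) \<le> ereal K" and wK: "Linf_norm \<Omega> (grad w) \<le> ereal K"
  shows "dual_norm \<Omega> \<T> (\<lambda>r. A_form \<Omega> a \<alpha> v r - A_form \<Omega> a \<alpha> w r)
    \<le> ennreal (a\<^sub>1 * (1 + 3 * \<alpha> * K\<^sup>2) * energy_norm \<Omega> (\<lambda>x. v x - w x))"
proof (rule dual_norm_le)
  have c: "0 \<le> a\<^sub>1 * (1 + 3 * \<alpha> * K\<^sup>2)"
    using a1_nonneg alpha_nonneg by simp
  then show "0 \<le> a\<^sub>1 * (1 + 3 * \<alpha> * K\<^sup>2) * energy_norm \<Omega> (\<lambda>x. v x - w x)"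
    using energy_norm_nonneg by simp
  \<comment> \<open>A function is almost everywhere below its essential supremum, which turns the
    extended real hypothesis into a real pointwise bound.\<close>
  have "AE x in \<mu>. norm (grad u x) \<le> K" if "Linf_norm \<Omega> (grad u) \<le> ereal K" for u
    using esssup_AE[of "\<lambda>x. ereal (norm (grad u x))" \<mu>]
    by eventually_elim (use that in \<open>auto simp: Linf_norm_def dest: order_trans\<close>)
  from this[OF vK] this[OF wK] a_bounds AE_grad_diff[OF v w]
  have le: "AE x in \<mu>. norm (a x *\<^sub>R (flux \<alpha> (grad v x) - flux \<alpha> (grad w x)))
      \<le> a\<^sub>1 * (1 + 3 * \<alpha> * K\<^sup>2) * norm (grad (\<lambda>x. v x - w x) x)"
  proof eventually_elim
    case (elim x)
    then show ?case
      using a0_pos a1_nonneg flux_lipschitz[OF alpha_nonneg elim(1,2)]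
      by (auto simp: mult.assoc intro!: mult_mono)
  qed
  fix r assume r: "r \<in> V"
  show "\<bar>A_form \<Omega> a \<alpha> v r - A_form \<Omega> a \<alpha> w r\<bar>
      \<le> a\<^sub>1 * (1 + 3 * \<alpha> * K\<^sup>2) * energy_norm \<Omega> (\<lambda>x. v x - w x) * energy_norm \<Omega> r"
    unfolding A_form_diff[OF v w r]
    by (rule integral_inner_grad_le[OF _ fe_space_diff[OF v w] r c le]) (intro ess_bdd v w)
qed

section \<open>Differentiability of the form\<close>

text \<open>Integrating the pointwise expansion makes the form an exact cubic polynomial in
  \<open>t\<close>. Differentiating at 0 yields the directional derivative, and setting
  \<open>t = 1\<close> yields the Frechet remainder.\<close>

lemma A_form_expand:
  assumes u: "u \<in> V" and z: "z \<in> V" and r: "r \<in> V"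
  shows "A_form \<Omega> a \<alpha> (\<lambda>x. u x + t * z x) r = A_form \<Omega> a \<alpha> u r + t * A_deriv \<Omega> a \<alpha> u z r
    + t\<^sup>2 * (\<integral>x. (a x *\<^sub>R flux_quad \<alpha> (grad u x) (grad z x)) \<bullet> grad r x \<partial>\<mu>)
    + t ^ 3 * (\<integral>x. (a x *\<^sub>R flux_cubic \<alpha> (grad z x)) \<bullet> grad r x \<partial>\<mu>)"
proof -
  note uz = fe_space_add_mult[OF u z, of t]
  define I where "I P = (\<lambda>x. (a x *\<^sub>R P x) \<bullet> grad r x)" for P
  have int: "integrable \<mu> (I P)" if "ess_bounded \<mu> P" for P
    unfolding I_def by (intro ess_bounded_integrable ess_bdd that r)
  note ints = int[OF ess_bounded_flux(1)[OF grad_ess_bounded[OF u], of \<alpha>]]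
    int[OF ess_bounded_flux(3)[OF grad_ess_bounded[OF u] grad_ess_bounded[OF z], of \<alpha>]]
    int[OF ess_bounded_flux(4)[OF grad_ess_bounded[OF u] grad_ess_bounded[OF z], of \<alpha>]]
    int[OF ess_bounded_flux(2)[OF grad_ess_bounded[OF z], of \<alpha>]]
  have "A_form \<Omega> a \<alpha> (\<lambda>x. u x + t * z x) r
      = (\<integral>x. (a x *\<^sub>R flux \<alpha> (grad u x + t *\<^sub>R grad z x)) \<bullet> grad r x \<partial>\<mu>)"
    unfolding A_form_flux
  proof (rule integral_cong_AE)
    show "AE x in \<mu>. (a x *\<^sub>R flux \<alpha> (grad (\<lambda>x. u x + t * z x) x)) \<bullet> grad r x
        = (a x *\<^sub>R flux \<alpha> (grad u x + t *\<^sub>R grad z x)) \<bullet> grad r x"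
      using AE_grad_add_mult[OF u z, of t] by eventually_elim simp
  qed (intro ess_bounded_measurable ess_bdd u z r uz)+
  also have "\<dots> = (\<integral>x. I (\<lambda>x. flux \<alpha> (grad u x)) x
      + t * I (\<lambda>x. flux_deriv \<alpha> (grad u x) (grad z x)) x
      + t\<^sup>2 * I (\<lambda>x. flux_quad \<alpha> (grad u x) (grad z x)) x
      + t ^ 3 * I (\<lambda>x. flux_cubic \<alpha> (grad z x)) x \<partial>\<mu>)"
    by (simp add: flux_expand I_def inner_add distrib_left mult.left_commute)
  also have "\<dots> = (\<integral>x. I (\<lambda>x. flux \<alpha> (grad u x)) x \<partial>\<mu>)
      + t * (\<integral>x. I (\<lambda>x. flux_deriv \<alpha> (grad u x) (grad z x)) x \<partial>\<mu>)
      + t\<^sup>2 * (\<integral>x. I (\<lambda>x. flux_quad \<alpha> (grad u x) (grad z x)) x \<partial>\<mu>)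
      + t ^ 3 * (\<integral>x. I (\<lambda>x. flux_cubic \<alpha> (grad z x)) x \<partial>\<mu>)"
    using ints by simp
  finally show ?thesis
    by (simp add: I_def A_form_flux A_deriv_flux[OF u z r])
qed

lemma A_form_gateaux:
  assumes "u \<in> V" "z \<in> V" "r \<in> V"
  shows "((\<lambda>t. A_form \<Omega> a \<alpha> (\<lambda>x. u x + t * z x) r)
    has_real_derivative A_deriv \<Omega> a \<alpha> u z r) (at 0)"
  unfolding A_form_expand[OF assms] by (auto intro!: derivative_eq_intros)

lemma A_deriv_coercive:
  assumes u: "u \<in> V" and z: "z \<in> V"
  shows "a\<^sub>0 * (energy_norm \<Omega> z)\<^sup>2 \<le> A_deriv \<Omega> a \<alpha> u z z"
proof -
  have "a\<^sub>0 * (energy_norm \<Omega> z)\<^sup>2 = (\<integral>x. a\<^sub>0 * (norm (grad z x))\<^sup>2 \<partial>\<mu>)"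
    by (simp add: energy_norm_sq)
  also have "\<dots> \<le> (\<integral>x. (a x *\<^sub>R flux_deriv \<alpha> (grad u x) (grad z x)) \<bullet> grad z x \<partial>\<mu>)"
  proof (rule integral_mono_AE)
    show "AE x in \<mu>. a\<^sub>0 * (norm (grad z x))\<^sup>2
      \<le> (a x *\<^sub>R flux_deriv \<alpha> (grad u x) (grad z x)) \<bullet> grad z x"
      using a_bounds
    proof eventually_elim
      case (elim x)
      then show ?case
        using a0_pos flux_deriv_coercive[OF alpha_nonneg, of "grad z x" "grad u x"]
        by (auto intro!: mult_mono)
    qed
  qed (intro ess_bounded_integrable ess_bdd u z)+
  finally show ?thesis
    by (simp add: A_deriv_flux[OF u z z])
qed

text \<open>Symmetry transfers linearity from the test function to the direction.\<close>

lemma A_deriv_commute: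
  "A_deriv \<Omega> a \<alpha> u z r = A_deriv \<Omega> a \<alpha> u r z"
  by (simp add: A_deriv_def inner_commute mult_ac)

lemma A_deriv_linear:
  assumes u: "u \<in> V" and z: "z \<in> V"
  shows "linear_functional_on_fe \<Omega> \<T> (A_deriv \<Omega> a \<alpha> u z)"
  unfolding linear_functional_on_fe_def
proof (intro ballI allI)
  fix v w and b c :: real
  assume v: "v \<in> V" and w: "w \<in> V"
  note l = fe_space_lincomb[OF v w, of b c]
  let ?P = "\<lambda>x. a x *\<^sub>R flux_deriv \<alpha> (grad u x) (grad z x)"
  have "(\<integral>x. ?P x \<bullet> grad (\<lambda>x. b * v x + c * w x) x \<partial>\<mu>)
      = (\<integral>x. b * (?P x \<bullet> grad v x) + c * (?P x \<bullet> grad w x) \<partial>\<mu>)"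
  proof (rule integral_cong_AE)
    show "AE x in \<mu>. ?P x \<bullet> grad (\<lambda>x. b * v x + c * w x) x
        = b * (?P x \<bullet> grad v x) + c * (?P x \<bullet> grad w x)"
      using AE_grad_lincomb[OF v w, of b c] by eventually_elim (simp add: inner_add algebra_simps)
  qed (intro ess_bounded_measurable ess_bdd u z v w l)+
  also have "\<dots> = b * (\<integral>x. ?P x \<bullet> grad v x \<partial>\<mu>) + c * (\<integral>x. ?P x \<bullet> grad w x \<partial>\<mu>)"
    by (subst Bochner_Integration.integral_add)
      (intro ess_bounded_integrable ess_bdd u z v w | simp del: inner_scaleR_left)+
  finally show "A_deriv \<Omega> a \<alpha> u z (\<lambda>x. b * v x + c * w x)
      = b * A_deriv \<Omega> a \<alpha> u z v + c * A_deriv \<Omega> a \<alpha> u z w"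
    by (simp only: A_deriv_flux[OF u z] v w l)
qed

lemma A_deriv_bounded:
  assumes u: "u \<in> V"
  shows "\<exists>B\<ge>0. \<forall>z\<in>V. dual_norm \<Omega> \<T> (A_deriv \<Omega> a \<alpha> u z) \<le> ennreal (B * energy_norm \<Omega> z)"
proof -
  obtain K where K: "AE x in \<mu>. norm (grad u x) \<le> K"
    using grad_ess_bounded[OF u] by (auto simp: ess_bounded_def)
  define B where "B = a\<^sub>1 * (1 + 3 * \<alpha> * K\<^sup>2)"
  have B: "0 \<le> B"
    using a1_nonneg alpha_nonneg by (simp add: B_def)
  have "dual_norm \<Omega> \<T> (A_deriv \<Omega> a \<alpha> u z) \<le> ennreal (B * energy_norm \<Omega> z)" if z: "z \<in> V" for z
  proof (rule dual_norm_le)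
    show "0 \<le> B * energy_norm \<Omega> z"
      using B energy_norm_nonneg by simp
    have le: "AE x in \<mu>. norm (a x *\<^sub>R flux_deriv \<alpha> (grad u x) (grad z x)) \<le> B * norm (grad z x)"
      using K a_bounds
    proof eventually_elim
      case (elim x)
      then show ?case
        using a0_pos a1_nonneg flux_deriv_bound[OF alpha_nonneg elim(1)]
        by (auto simp: B_def mult.assoc intro!: mult_mono)
    qed
    fix r assume r: "r \<in> V"
    show "\<bar>A_deriv \<Omega> a \<alpha> u z r\<bar> \<le> B * energy_norm \<Omega> z * energy_norm \<Omega> r"
      unfolding A_deriv_flux[OF u z r]
      by (rule integral_inner_grad_le[OF _ z r B le]) (intro ess_bdd u z)
  qed
  with B show ?thesis by blast
qed

text \<open>The remainder is quadratic in the gradient of the increment; the inverse estimate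
  bounds the extra factor in the supremum norm.\<close>

lemma A_form_remainder:
  assumes u: "u \<in> V"
  shows "\<exists>D\<ge>0. \<forall>z\<in>V. energy_norm \<Omega> z \<le> 1 \<longrightarrow>
    dual_norm \<Omega> \<T> (\<lambda>r. A_form \<Omega> a \<alpha> (\<lambda>x. u x + z x) r - A_form \<Omega> a \<alpha> u r - A_deriv \<Omega> a \<alpha> u z r)
      \<le> ennreal (D * (energy_norm \<Omega> z)\<^sup>2)"
proof -
  obtain K' where "AE x in \<mu>. norm (grad u x) \<le> K'"
    using grad_ess_bounded[OF u] by (auto simp: ess_bounded_def)
  \<comment> \<open>The absolute value supplies the sign used to check
    \<open>0 \<le> D\<close>.\<close>
  then have K: "AE x in \<mu>. norm (grad u x) \<le> \<bar>K'\<bar>"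
    by eventually_elim simp
  obtain M where M: "0 \<le> M" "\<And>v. v \<in> V \<Longrightarrow> AE x in \<mu>. norm (grad v x) \<le> M * energy_norm \<Omega> v"
    using inverse_estimate by blast
  \<comment> \<open>This comes from \<open>flux_remainder_bound\<close> with \<open>L\<close> equal
    to \<open>M\<close> times the energy norm of \<open>z\<close>, after one power of that norm is
    factored out.\<close>
  define D where "D = a\<^sub>1 * (\<alpha> * (3 * \<bar>K'\<bar> * M + M\<^sup>2))"
  have D: "0 \<le> D"
    using a1_nonneg alpha_nonneg M by (simp add: D_def)
  have "dual_norm \<Omega> \<T> (\<lambda>r. A_form \<Omega> a \<alpha> (\<lambda>x. u x + z x) r - A_form \<Omega> a \<alpha> u r - A_deriv \<Omega> a \<alpha> u z r)
      \<le> ennreal (D * (energy_norm \<Omega> z)\<^sup>2)"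
    if z: "z \<in> V" and z1: "energy_norm \<Omega> z \<le> 1" for z
  proof (rule dual_norm_le)
    let ?e = "energy_norm \<Omega> z"
    let ?R = "\<lambda>x. flux_quad \<alpha> (grad u x) (grad z x) + flux_cubic \<alpha> (grad z x)"
    show "0 \<le> D * ?e\<^sup>2" using D by simp
    have c: "0 \<le> D * ?e" using D energy_norm_nonneg by simp
    \<comment> \<open>Here the restriction to the unit ball enters: it reduces the square of
      \<open>M * ?e\<close> to a term linear in \<open>?e\<close>, so that a single constant
      \<open>D\<close> covers both parts of the remainder.\<close>
    have "?e\<^sup>2 \<le> ?e"
      using z1 energy_norm_nonneg[of z] by (simp add: power2_eq_square mult_left_le)
    then have "(M * ?e)\<^sup>2 \<le> M\<^sup>2 * ?e"
      unfolding power_mult_distrib by (rule mult_left_mono) simp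
    then have "a\<^sub>1 * (\<alpha> * (3 * \<bar>K'\<bar> * (M * ?e) + (M * ?e)\<^sup>2))
        \<le> a\<^sub>1 * (\<alpha> * (3 * \<bar>K'\<bar> * (M * ?e) + M\<^sup>2 * ?e))"
      using a1_nonneg alpha_nonneg by (intro mult_left_mono add_left_mono) auto
    also have "\<dots> = D * ?e"
      by (simp add: D_def algebra_simps)
    finally have De: "a\<^sub>1 * (\<alpha> * (3 * \<bar>K'\<bar> * (M * ?e) + (M * ?e)\<^sup>2)) \<le> D * ?e" .
    have le: "AE x in \<mu>. norm (a x *\<^sub>R ?R x) \<le> D * ?e * norm (grad z x)"
      using K M(2)[OF z] a_bounds
    proof eventually_elim
      case (elim x)
      have "norm (a x *\<^sub>R ?R x)
          \<le> a\<^sub>1 * (\<alpha> * (3 * \<bar>K'\<bar> * (M * ?e) + (M * ?e)\<^sup>2) * norm (grad z x))"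
        using elim(3) a0_pos a1_nonneg flux_remainder_bound[OF alpha_nonneg elim(1,2)]
        unfolding norm_scaleR by (intro mult_mono) auto
      also have "\<dots> \<le> D * ?e * norm (grad z x)"
        using De by (simp only: mult.assoc[symmetric]) (rule mult_right_mono, auto)
      finally show ?case .
    qed
    have R: "ess_bounded \<mu> (\<lambda>x. a x *\<^sub>R ?R x)"
      by (intro ess_bdd u z)
    fix r assume r: "r \<in> V"
    have "A_form \<Omega> a \<alpha> (\<lambda>x. u x + z x) r - A_form \<Omega> a \<alpha> u r - A_deriv \<Omega> a \<alpha> u z r
        = (\<integral>x. (a x *\<^sub>R flux_quad \<alpha> (grad u x) (grad z x)) \<bullet> grad r x \<partial>\<mu>)
          + (\<integral>x. (a x *\<^sub>R flux_cubic \<alpha> (grad z x)) \<bullet> grad r x \<partial>\<mu>)"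
      using A_form_expand[OF u z r, of 1] by simp
    also have "\<dots> = (\<integral>x. (a x *\<^sub>R ?R x) \<bullet> grad r x \<partial>\<mu>)"
      by (subst Bochner_Integration.integral_add[symmetric])
        (intro ess_bounded_integrable ess_bdd u z r | simp add: inner_add distrib_left)+
    finally show "\<bar>A_form \<Omega> a \<alpha> (\<lambda>x. u x + z x) r - A_form \<Omega> a \<alpha> u r - A_deriv \<Omega> a \<alpha> u z r\<bar>
        \<le> D * ?e\<^sup>2 * energy_norm \<Omega> r"
      using integral_inner_grad_le[OF R z r c le] by (simp add: power2_eq_square mult.assoc)
  qed
  with D show ?thesis by blast
qed

lemma A_form_frechet:
  assumes u: "u \<in> V"
  shows "has_fe_derivative \<Omega> \<T> (A_form \<Omega> a \<alpha>) (A_deriv \<Omega> a \<alpha> u) u"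
  unfolding has_fe_derivative_def
proof (intro conjI ballI allI impI)
  show "linear_functional_on_fe \<Omega> \<T> (A_deriv \<Omega> a \<alpha> u z)" if "z \<in> V" for z
    using u that by (rule A_deriv_linear)
  show "linear_functional_on_fe \<Omega> \<T> (\<lambda>z. A_deriv \<Omega> a \<alpha> u z r)" if "r \<in> V" for r
    using A_deriv_linear[OF u that] by (subst A_deriv_commute)
  show "\<exists>B\<ge>0. \<forall>z\<in>V. dual_norm \<Omega> \<T> (A_deriv \<Omega> a \<alpha> u z) \<le> ennreal (B * energy_norm \<Omega> z)"
    using u by (rule A_deriv_bounded)
  fix e :: real assume e: "0 < e"
  obtain D where D: "0 \<le> D" "\<And>z. z \<in> V \<Longrightarrow> energy_norm \<Omega> z \<le> 1 \<Longrightarrow>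
    dual_norm \<Omega> \<T> (\<lambda>r. A_form \<Omega> a \<alpha> (\<lambda>x. u x + z x) r - A_form \<Omega> a \<alpha> u r - A_deriv \<Omega> a \<alpha> u z r)
      \<le> ennreal (D * (energy_norm \<Omega> z)\<^sup>2)"
    using A_form_remainder[OF u] by blast
  \<comment> \<open>The 1 keeps \<open>z\<close> in the range of the remainder estimate, and the
    quotient makes \<open>D * energy_norm \<Omega> z\<close> at most \<open>e\<close>. Using
    \<open>D + 1\<close> avoids a zero denominator.\<close>
  define \<delta> where "\<delta> = min 1 (e / (D + 1))"
  show "\<exists>\<delta>>0. \<forall>z\<in>V. energy_norm \<Omega> z < \<delta> \<longrightarrow>
    dual_norm \<Omega> \<T> (\<lambda>r. A_form \<Omega> a \<alpha> (\<lambda>x. u x + z x) r - A_form \<Omega> a \<alpha> u r - A_deriv \<Omega> a \<alpha> u z r)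
      \<le> ennreal (e * energy_norm \<Omega> z)"
  proof (intro exI[of _ \<delta>] conjI ballI impI)
    show "0 < \<delta>" using e D by (simp add: \<delta>_def)
    fix z assume z: "z \<in> V" and zd: "energy_norm \<Omega> z < \<delta>"
    have "D * energy_norm \<Omega> z \<le> (D + 1) * energy_norm \<Omega> z"
      using energy_norm_nonneg by (simp add: mult_right_mono)
    also have "\<dots> \<le> e"
      using zd D by (simp add: \<delta>_def field_simps)
    finally have "D * (energy_norm \<Omega> z)\<^sup>2 \<le> e * energy_norm \<Omega> z"
      using energy_norm_nonneg[of z] by (simp add: power2_eq_square mult_right_mono flip: mult.assoc)
    with D(2)[OF z] zd
    show "dual_norm \<Omega> \<T> (\<lambda>r. A_form \<Omega> a \<alpha> (\<lambda>x. u x + z x) r - A_form \<Omega> a \<alpha> u r - A_deriv \<Omega> a \<alpha> u z r)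
        \<le> ennreal (e * energy_norm \<Omega> z)"
      by (auto simp: \<delta>_def intro: order_trans ennreal_leI)
  qed
qed

end


theorem proposition6p1:
  fixes \<sigma> :: real
  shows "\<exists>C>0. \<forall>(\<Omega> :: (real^'n) set) \<T> q a a\<^sub>0 a\<^sub>1 \<alpha>.
    polyhedral_domain \<Omega> \<longrightarrow>
    triangulation_of \<T> \<Omega> \<longrightarrow> shape_regular \<sigma> \<T> \<longrightarrow> quasi_uniform q \<T> \<longrightarrow>
    a \<in> Linf \<Omega> \<longrightarrow> 0 < a\<^sub>0 \<longrightarrow> (AE x in lebesgue_on \<Omega>. a\<^sub>0 \<le> a x \<and> a x \<le> a\<^sub>1) \<longrightarrow>
    0 \<le> \<alpha> \<longrightarrow>
    (\<forall>v\<in>fe_space \<Omega> \<T>. \<forall>w\<in>fe_space \<Omega> \<T>.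
       A_form \<Omega> a \<alpha> v (\<lambda>x. v x - w x) - A_form \<Omega> a \<alpha> w (\<lambda>x. v x - w x)
         \<ge> a\<^sub>0 * (energy_norm \<Omega> (\<lambda>x. v x - w x))\<^sup>2) \<and>
    (\<forall>K>0. \<forall>v\<in>{v \<in> fe_space \<Omega> \<T>. Linf_norm \<Omega> (grad v) \<le> ereal K}.
           \<forall>w\<in>{v \<in> fe_space \<Omega> \<T>. Linf_norm \<Omega> (grad v) \<le> ereal K}.
       dual_norm \<Omega> \<T> (\<lambda>r. A_form \<Omega> a \<alpha> v r - A_form \<Omega> a \<alpha> w r)
         \<le> ennreal (a\<^sub>1 * (1 + C * \<alpha> * K\<^sup>2) * energy_norm \<Omega> (\<lambda>x. v x - w x))) \<and>
    (\<forall>u\<in>fe_space \<Omega> \<T>.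
       has_fe_derivative \<Omega> \<T> (A_form \<Omega> a \<alpha>) (A_deriv \<Omega> a \<alpha> u) u \<and>
       (\<forall>z\<in>fe_space \<Omega> \<T>. \<forall>r\<in>fe_space \<Omega> \<T>.
          ((\<lambda>t. A_form \<Omega> a \<alpha> (\<lambda>x. u x + t * z x) r)
             has_real_derivative A_deriv \<Omega> a \<alpha> u z r) (at 0)) \<and>
       (\<forall>z\<in>fe_space \<Omega> \<T>. A_deriv \<Omega> a \<alpha> u z z \<ge> a\<^sub>0 * (energy_norm \<Omega> z)\<^sup>2))"
proof (intro exI[of _ 3] conjI allI impI)
  fix \<Omega> :: "(real^'n) set" and \<T> a and q a\<^sub>0 a\<^sub>1 \<alpha> :: real
  assume "polyhedral_domain \<Omega>" "triangulation_of \<T> \<Omega>" "a \<in> Linf \<Omega>" "0 < a\<^sub>0"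
    "AE x in lebesgue_on \<Omega>. a\<^sub>0 \<le> a x \<and> a x \<le> a\<^sub>1" "0 \<le> \<alpha>"
  \<comment> \<open>Polyhedrality supplies an open, bounded, nonempty domain, and membership in
    \<open>Linf\<close> supplies measurability of \<open>a\<close>.\<close>
  then interpret fe_problem \<Omega> \<T> a a\<^sub>0 a\<^sub>1 \<alpha>
    by unfold_locales (auto simp: polyhedral_domain_def Linf_def)
  show "\<forall>v\<in>V. \<forall>w\<in>V. A_form \<Omega> a \<alpha> v (\<lambda>x. v x - w x) - A_form \<Omega> a \<alpha> w (\<lambda>x. v x - w x)
      \<ge> a\<^sub>0 * (energy_norm \<Omega> (\<lambda>x. v x - w x))\<^sup>2"
    using A_form_strongly_monotone by blast
  show "\<forall>v\<in>{v \<in> V. Linf_norm \<Omega> (grad v) \<le> ereal K}. \<forall>w\<in>{v \<in> V. Linf_norm \<Omega> (grad v) \<le> ereal K}.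
      dual_norm \<Omega> \<T> (\<lambda>r. A_form \<Omega> a \<alpha> v r - A_form \<Omega> a \<alpha> w r)
        \<le> ennreal (a\<^sub>1 * (1 + 3 * \<alpha> * K\<^sup>2) * energy_norm \<Omega> (\<lambda>x. v x - w x))" for K
    using A_form_locally_lipschitz by blast
  show "\<forall>u\<in>V. has_fe_derivative \<Omega> \<T> (A_form \<Omega> a \<alpha>) (A_deriv \<Omega> a \<alpha> u) u \<and>
      (\<forall>z\<in>V. \<forall>r\<in>V. ((\<lambda>t. A_form \<Omega> a \<alpha> (\<lambda>x. u x + t * z x) r)
          has_real_derivative A_deriv \<Omega> a \<alpha> u z r) (at 0)) \<and>
      (\<forall>z\<in>V. A_deriv \<Omega> a \<alpha> u z z \<ge> a\<^sub>0 * (energy_norm \<Omega> z)\<^sup>2)"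
    using A_form_frechet A_form_gateaux A_deriv_coercive by blast
qed simp

end
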